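(* Let $\mathbb{K}$ be one of $\mathbb{R},\mathbb{C},\mathbb{H}$, let $n\ge 1$, and let $V\subset\mathbb{K}^n$ be a $\mathbb{K}$-linear subspace (left $\mathbb{K}$-submodule), with orthogonal complement $V^\perp=\{y\in\mathbb{K}^n\mid \langle x,y\rangle=0 \text{ for all } x\in V\}$ with respect to the standard Hermitian form. Then $$\mathcal{M}(V^\perp)=\mathcal{M}(V)^\perp ,$$ where $\mathcal{M}(L)$ denotes the $\mathbb{K}$-matroid of a subspace $L$ and, for a set $\mathcal{M}$ of sign vectors, $\mathcal{M}^\perp$ is the set of sign vectors orthogonal to every element of $\mathcal{M}$.
   Context: $\mathbb{K}^n$ is regarded as a left $\mathbb{K}$-module with the form $\langle x,y\rangle=x_1\bar y_1+\dots+x_n\bar y_n$. The $\mathbb{K}$-cross polytope is the convex body $\lozenge^n_{\mathbb{K}}=\mathrm{conv}\bigcup_{i=1}^n S_i\subset\mathbb{K}^n$, where $S_i=\{z\in\mathbb{K}^n\mid |z_i|=1 \text{ and } z_j=0 \text{ for all } j\ne i\}$. It contains $0$ in its interior. A non-empty closed convex set $A\subseteq \lozenge^n_{\mathbb{K}}$ is a face if for each segment $[a,b]\subset\lozenge^n_{\mathbb{K}}$, $(a,b)\cap A\ne\emptyset$ implies $\{a,b\}\subset A$. Let $\mathcal{F}_{\mathbb{K}}$ be the set consisting of all non-empty proper faces of $\lozenge^n_{\mathbb{K}}$ (i.e. faces different from $\lozenge^n_{\mathbb{K}}$ itself) together with the empty face $\emptyset$. Elements of $\mathcal{F}_{\mathbb{K}}$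 are called sign vectors. The sign map $\nu:\mathbb{K}^n\to\mathcal{F}_{\mathbb{K}}$ is defined as follows: for $v\neq 0$, $\nu(v)$ is the unique non-empty proper face $F$ such that the ray $\{\lambda v\mid\lambda\ge 0\}$ meets $\mathrm{relint}(F)$; and $\nu(0)=\emptyset$. (For $\mathbb{K}=\mathbb{R}$ this is the usual sign vector in $\{-1,0,+1\}^n$.) The $\mathbb{K}$-matroid of a subspace $L\subset\mathbb{K}^n$ is $\mathcal{M}(L)=\{\nu(v)\mid v\in L\}$; equivalently, it consists of $\emptyset$ and all non-empty proper faces $A$ with $\mathrm{relint}(A)\cap L\ne\emptyset$. Two sign vectors $a,b\in\mathcal{F}_{\mathbb{K}}$ are orthogonal, $a\perp b$, if there exist $x,y\in\mathbb{K}^n$ with $a=\nu(x)$, $b=\nu(y)$ and $\langle x,y\rangle=0$. For $\mathcal{M}\subset\mathcal{F}_{\mathbb{K}}$, $\mathcal{M}^\perp=\{b\in\mathcal{F}_{\mathbb{K}}\mid a\perp b \text{ for all } a\in\mathcal{M}\}$. *)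

theory Defs
  imports "HOL-Analysis.Analysis"
begin

section \<open>Quaternions\<close>

text \<open>
  \<open>Quat a b c d\<close> is $a + b\,i + c\,j + d\,k$ with $i^2 = j^2 = k^2 = ijk = -1$. The instances
  provide the division ring structure together with the usual norm and the Euclidean
  structure of $\mathbb{R}^4$.
\<close>

codatatype quat = Quat (qRe: real) (qI: real) (qJ: real) (qK: real)

lemma quat_eqI:
  "\<lbrakk>qRe x = qRe y; qI x = qI y; qJ x = qJ y; qK x = qK y\<rbrakk> \<Longrightarrow> x = y"
  by (rule quat.expand) simp

lemma quat_eq_iff:
  "x = y \<longleftrightarrow> qRe x = qRe y \<and> qI x = qI y \<and> qJ x = qJ y \<and> qK x = qK y"
  by (auto intro: quat_eqI)

instantiation quat :: ring_1
begin

primcorec zero_quat where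
  "qRe 0 = 0" | "qI 0 = 0" | "qJ 0 = 0" | "qK 0 = 0"

primcorec one_quat where
  "qRe 1 = 1" | "qI 1 = 0" | "qJ 1 = 0" | "qK 1 = 0"

primcorec plus_quat where
  "qRe (x + y) = qRe x + qRe y"
| "qI (x + y) = qI x + qI y"
| "qJ (x + y) = qJ x + qJ y"
| "qK (x + y) = qK x + qK y"

primcorec uminus_quat where
  "qRe (- x) = - qRe x" | "qI (- x) = - qI x" | "qJ (- x) = - qJ x" | "qK (- x) = - qK x"

primcorec minus_quat where
  "qRe (x - y) = qRe x - qRe y"
| "qI (x - y) = qI x - qI y"
| "qJ (x - y) = qJ x - qJ y"
| "qK (x - y) = qK x - qK y"

primcorec times_quat where
  "qRe (x * y) = qRe x * qRe y - qI x * qI y - qJ x * qJ y - qK x * qK y"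
| "qI (x * y) = qRe x * qI y + qI x * qRe y + qJ x * qK y - qK x * qJ y"
| "qJ (x * y) = qRe x * qJ y - qI x * qK y + qJ x * qRe y + qK x * qI y"
| "qK (x * y) = qRe x * qK y + qI x * qJ y - qJ x * qI y + qK x * qRe y"

instance
  by standard (simp_all add: quat_eq_iff algebra_simps)

end

instantiation quat :: real_algebra_1
begin

primcorec scaleR_quat where
  "qRe (scaleR r x) = r * qRe x"
| "qI (scaleR r x) = r * qI x"
| "qJ (scaleR r x) = r * qJ x"
| "qK (scaleR r x) = r * qK x"

instance
  by standard (simp_all add: quat_eq_iff algebra_simps)

end

instantiation quat :: real_inner
begin

definition inner_quat :: "quat \<Rightarrow> quat \<Rightarrow> real" where
  "inner_quat x y = qRe x * qRe y + qI x * qI y + qJ x * qJ y + qK x * qK y"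

definition norm_quat :: "quat \<Rightarrow> real" where
  "norm_quat x = sqrt ((qRe x)\<^sup>2 + (qI x)\<^sup>2 + (qJ x)\<^sup>2 + (qK x)\<^sup>2)"

definition sgn_quat :: "quat \<Rightarrow> quat" where
  "sgn_quat x = x /\<^sub>R norm x"

definition dist_quat :: "quat \<Rightarrow> quat \<Rightarrow> real" where
  "dist_quat x y = norm (x - y)"

definition uniformity_quat :: "(quat \<times> quat) filter" where
  "uniformity_quat = (INF e\<in>{0<..}. principal {(x, y). dist x y < e})"

definition open_quat :: "quat set \<Rightarrow> bool" where
  "open_quat U \<longleftrightarrow> (\<forall>x\<in>U. \<forall>\<^sub>F (x', y) in uniformity. x' = x \<longrightarrow> y \<in> U)"

instance
proof
  fix x y z :: quat and r :: real
  show "inner x x = 0 \<longleftrightarrow> x = 0"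
    by (auto simp: inner_quat_def quat_eq_iff add_nonneg_eq_0_iff)
qed (auto simp: inner_quat_def norm_quat_def sgn_quat_def dist_quat_def uniformity_quat_def
       open_quat_def algebra_simps power2_eq_square)

end

instantiation quat :: real_normed_div_algebra
begin

definition inverse_quat :: "quat \<Rightarrow> quat" where
  "inverse_quat x = Quat (qRe x) (- qI x) (- qJ x) (- qK x) /\<^sub>R (norm x)\<^sup>2"

definition divide_quat :: "quat \<Rightarrow> quat \<Rightarrow> quat" where
  "divide_quat x y = x * inverse y"

instance
proof
  fix x y :: quat
  let ?c = "Quat (qRe x) (- qI x) (- qJ x) (- qK x)"
  have "?c * x = (norm x)\<^sup>2 *\<^sub>R 1" "x * ?c = (norm x)\<^sup>2 *\<^sub>R 1"
    by (simp_all add: quat_eq_iff norm_quat_def power2_eq_square)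
  then show "inverse x * x = 1" "x * inverse x = 1" if "x \<noteq> 0"
    using that by (simp_all add: inverse_quat_def)
  show "x div y = x * inverse y"
    by (simp add: divide_quat_def)
  show "inverse (0::quat) = 0"
    by (simp add: inverse_quat_def)
  show "norm (x * y) = norm x * norm y"
    unfolding norm_quat_def real_sqrt_mult[symmetric]
    by (rule arg_cong[where f = sqrt]) (simp add: power2_eq_square algebra_simps)
qed

end

instantiation quat :: euclidean_space
begin

definition Basis_quat :: "quat set" where
  "Basis_quat = {Quat 1 0 0 0, Quat 0 1 0 0, Quat 0 0 1 0, Quat 0 0 0 1}"

instance
proof
  fix x :: quat
  show "(\<forall>u\<in>Basis. inner x u = 0) \<longleftrightarrow> x = 0"
    by (simp add: Basis_quat_def inner_quat_def quat_eq_iff[of x])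
qed (auto simp: Basis_quat_def inner_quat_def)

end


section \<open>Conjugation on the scalars\<close>

class conjugation =
  fixes conjug :: "'a \<Rightarrow> 'a"

instantiation real :: conjugation
begin
definition conjug_real :: "real \<Rightarrow> real" where "conjug_real x = x"
instance ..
end

instantiation complex :: conjugation
begin
definition conjug_complex :: "complex \<Rightarrow> complex" where "conjug_complex x = cnj x"
instance ..
end

instantiation quat :: conjugation
begin
definition conjug_quat :: "quat \<Rightarrow> quat" where
  "conjug_quat x = Quat (qRe x) (- qI x) (- qJ x) (- qK x)"
instance ..
end


section \<open>Left subspaces and the Hermitian form\<close>

text \<open>
  The library's \<open>module\<close> and \<open>vector_space\<close> locales need commutative scalars, so left subspaces
  are defined directly; \<open>(*s)\<close> multiplies every coordinate by the scalar from the left.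
\<close>

definition left_subspace :: "('k::ring_1 ^ 'n) set \<Rightarrow> bool" where
  "left_subspace V \<longleftrightarrow>
     0 \<in> V \<and> (\<forall>x\<in>V. \<forall>y\<in>V. x + y \<in> V) \<and> (\<forall>c. \<forall>x\<in>V. c *s x \<in> V)"

definition hform :: "'k::{ring_1, conjugation} ^ 'n::finite \<Rightarrow> 'k ^ 'n \<Rightarrow> 'k" where
  "hform x y = (\<Sum>i\<in>UNIV. x $ i * conjug (y $ i))"

definition orth_complement :: "('k::{ring_1, conjugation} ^ 'n::finite) set \<Rightarrow> ('k ^ 'n) set" where
  "orth_complement V = {y. \<forall>x\<in>V. hform x y = 0}"


section \<open>The cross polytope and its sign vectors\<close>

definition coord_sphere :: "'n \<Rightarrow> ('k::real_normed_vector ^ 'n::finite) set" where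
  "coord_sphere i = {z. norm (z $ i) = 1 \<and> (\<forall>j. j \<noteq> i \<longrightarrow> z $ j = 0)}"

definition cross_polytope :: "('k::real_normed_vector ^ 'n::finite) set" where
  "cross_polytope = convex hull (\<Union>i. coord_sphere i)"

definition proper_faces :: "('k::real_normed_vector ^ 'n::finite) set set" where
  "proper_faces =
     {A. A \<noteq> {} \<and> closed A \<and> A face_of cross_polytope \<and> A \<noteq> cross_polytope}"

definition sign_vectors :: "('k::real_normed_vector ^ 'n::finite) set set" where
  "sign_vectors = insert {} proper_faces"

definition sign_map :: "'k::real_normed_vector ^ 'n::finite \<Rightarrow> ('k ^ 'n) set" where
  "sign_map v =
     (if v = 0 then {}
      else THE F. F \<in> proper_faces \<and> (\<exists>t\<ge>0. t *\<^sub>R v \<in> rel_interior F))"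

definition matroid_of :: "('k::real_normed_vector ^ 'n::finite) set \<Rightarrow> ('k ^ 'n) set set" where
  "matroid_of L = sign_map ` L"

definition sign_orthogonal ::
    "('k::{real_normed_algebra_1, conjugation} ^ 'n::finite) set \<Rightarrow> ('k ^ 'n) set \<Rightarrow> bool" where
  "sign_orthogonal a b \<longleftrightarrow> (\<exists>x y. a = sign_map x \<and> b = sign_map y \<and> hform x y = 0)"

definition matroid_perp ::
    "('k::{real_normed_algebra_1, conjugation} ^ 'n::finite) set set \<Rightarrow> ('k ^ 'n) set set" where
  "matroid_perp M = {b \<in> sign_vectors. \<forall>a\<in>M. sign_orthogonal a b}"

end

theory Submission
  imports Defs
begin

text \<open>
  The cross polytope is the unit ball of the norm $\sum_i |x_i|$, and the face met by the ray
  through $v \neq 0$ is the one exposed by the functional $x \mapsto \sum_i \mathrm{Re}\,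
  x_i \overline{\mathrm{sgn}\, v_i}$. Hence $\nu(v)$ records precisely the phases
  $\mathrm{sgn}\, v_i$. The real inner product is the real part of the Hermitian form, so
  $V^\perp$ is also the real orthogonal complement of $V$. If no vector of $V^\perp$ has the
  phases of $y$, the convex cone $C$ of all vectors with these phases misses $V^\perp$; separating
  $0$ from $C + V^\perp$ gives some $a \in V^{\perp\perp} = V$ with
  $\mathrm{Re}\, a_i \overline{y_i} \ge 0$ for all $i$, strictly for some $i$. Then
  $\mathrm{Re}\,\langle x', y'\rangle > 0$ whenever $x'$, $y'$ have the phases of $a$, $y$, so
  $\nu(y)$ is not orthogonal to $\nu(a)$.
\<close>

section \<open>The cross polytope as a unit ball\<close>

lemma convex_l1_ball: "convex {x :: 'k::real_normed_vector ^ 'n::finite. (\<Sum>i\<in>UNIV. norm (x $ i)) \<le> r}"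
proof (rule convexI, clarify)
  fix x y :: "'k ^ 'n" and a b :: real
  assume x: "(\<Sum>i\<in>UNIV. norm (x $ i)) \<le> r" and y: "(\<Sum>i\<in>UNIV. norm (y $ i)) \<le> r"
    and ab: "0 \<le> a" "0 \<le> b" "a + b = 1"
  have "(\<Sum>i\<in>UNIV. norm ((a *\<^sub>R x + b *\<^sub>R y) $ i))
      \<le> (\<Sum>i\<in>UNIV. a * norm (x $ i) + b * norm (y $ i))"
    using ab by (intro sum_mono) (auto intro!: norm_triangle_le)
  also have "\<dots> = a * (\<Sum>i\<in>UNIV. norm (x $ i)) + b * (\<Sum>i\<in>UNIV. norm (y $ i))"
    by (simp add: sum.distrib sum_distrib_left)
  also have "\<dots> \<le> r"
    using convex_bound_le[OF x y ab] .
  finally show "(\<Sum>i\<in>UNIV. norm ((a *\<^sub>R x + b *\<^sub>R y) $ i)) \<le> r" .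
qed

lemma norm_scaleR_sgn: "norm x *\<^sub>R sgn x = x" for x :: "'a::real_normed_vector"
  by (cases "x = 0") (simp_all add: sgn_div_norm)

lemma sgn_sgn: "sgn (sgn x) = sgn x" for x :: "'a::real_normed_vector"
  by (cases "x = 0") (simp_all add: sgn_div_norm[of "sgn x"] norm_sgn)

lemma axis_mem_cross_polytope:
  fixes c :: "'k::real_normed_vector"
  assumes "norm c = 1"
  shows "axis i c \<in> cross_polytope"
  unfolding cross_polytope_def
  by (rule hull_inc) (use assms in \<open>auto simp: coord_sphere_def axis_def intro!: exI[of _ i]\<close>)

lemma zero_mem_cross_polytope:
  "(0 :: 'k::real_normed_algebra_1 ^ 'n::finite) \<in> cross_polytope"
proof -
  \<comment> \<open>Types are nonempty, so a coordinate exists; this is where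
    \<open>n \<ge> 1\<close> enters. The origin is then the midpoint of two antipodal
    generators.\<close>
  fix i :: 'n
  have "axis i 1 \<in> (cross_polytope :: ('k ^ 'n) set)" "axis i (- 1) \<in> (cross_polytope :: ('k ^ 'n) set)"
    by (simp_all add: axis_mem_cross_polytope)
  then have "(1/2) *\<^sub>R axis i 1 + (1/2) *\<^sub>R axis i (- 1) \<in> (cross_polytope :: ('k ^ 'n) set)"
    unfolding cross_polytope_def by (intro convexD[OF convex_convex_hull]) auto
  also have "(1/2) *\<^sub>R axis i 1 + (1/2) *\<^sub>R axis i (- 1) = (0 :: 'k ^ 'n)"
    by (simp add: vec_eq_iff axis_def)
  finally show ?thesis .
qed

text \<open>The generators have norm sum 1 and the ball is convex. Conversely, a point with norm sum
  \<open>s > 0\<close> is \<open>s\<close> times a convex combination of unit vectors on the axes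
  carrying its phases; shrinking towards the origin supplies the factor \<open>s\<close>.\<close>

lemma cross_polytope_eq:
  "cross_polytope = {x :: 'k::real_normed_algebra_1 ^ 'n::finite. (\<Sum>i\<in>UNIV. norm (x $ i)) \<le> 1}"
proof
  have "(\<Sum>j\<in>UNIV. norm (z $ j)) = 1" if "z \<in> coord_sphere i" for z :: "'k ^ 'n" and i
    using that by (simp add: coord_sphere_def sum.remove[of UNIV i])
  then show "cross_polytope \<subseteq> {x :: 'k ^ 'n. (\<Sum>i\<in>UNIV. norm (x $ i)) \<le> 1}"
    unfolding cross_polytope_def by (intro hull_minimal convex_l1_ball) auto
next
  have cvx: "convex (cross_polytope :: ('k ^ 'n) set)"
    unfolding cross_polytope_def by (rule convex_convex_hull)
  show "{x. (\<Sum>i\<in>UNIV. norm (x $ i)) \<le> 1} \<subseteq> (cross_polytope :: ('k ^ 'n) set)"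
  proof clarify
    fix x :: "'k ^ 'n"
    define s where "s = (\<Sum>i\<in>UNIV. norm (x $ i))"
    assume "(\<Sum>i\<in>UNIV. norm (x $ i)) \<le> 1"
    then have s1: "s \<le> 1" by (simp add: s_def)
    have s0: "s \<ge> 0" by (simp add: s_def sum_nonneg)
    show "x \<in> cross_polytope"
    proof (cases "s = 0")
      case True
      then have "x = 0"
        by (simp add: s_def sum_nonneg_eq_0_iff vec_eq_iff)
      then show ?thesis by (simp add: zero_mem_cross_polytope)
    next
      case False
      define y where "y = (\<Sum>i\<in>UNIV. (norm (x $ i) / s) *\<^sub>R axis i (sgn (x $ i)))"
      have "y \<in> cross_polytope"
        unfolding y_def
      proof (rule convex_sum[OF finite cvx])
        show "(\<Sum>i\<in>UNIV. norm (x $ i) / s) = 1"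
          using False by (simp add: s_def flip: sum_divide_distrib)
        \<comment> \<open>At a vanishing coordinate \<open>sgn 0 = 0\<close>, so the point combined
          there is the origin rather than a generator.\<close>
        show "axis i (sgn (x $ i)) \<in> cross_polytope" for i
        proof (cases "x $ i = 0")
          case True
          then have "axis i (sgn (x $ i)) = 0" by (simp add: axis_eq_0_iff)
          then show ?thesis by (simp only: zero_mem_cross_polytope)
        qed (simp add: axis_mem_cross_polytope norm_sgn)
      qed (use s0 in simp)
      then have "s *\<^sub>R y + (1 - s) *\<^sub>R 0 \<in> cross_polytope"
        using s0 s1 by (intro convexD[OF cvx] zero_mem_cross_polytope) auto
      moreover have "s *\<^sub>R y = x"
        using False
        by (simp add: y_def vec_eq_iff axis_def if_distrib[of "scaleR _"] norm_scaleR_sgn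
            cong: if_cong)
      ultimately show ?thesis by simp
    qed
  qed
qed

text \<open>A proper face misses the interior of the polytope, and this interior contains the open
  unit ball.\<close>

lemma proper_face_l1_norm:
  fixes F :: "('k::real_normed_algebra_1 ^ 'n::finite) set"
  assumes "F \<in> proper_faces" "x \<in> F"
  shows "(\<Sum>i\<in>UNIV. norm (x $ i)) = 1"
proof -
  have "F face_of cross_polytope" "F \<noteq> cross_polytope"
    using assms by (auto simp: proper_faces_def)
  then have disj: "F \<inter> interior cross_polytope = {}" and sub: "F \<subseteq> cross_polytope"
    by (auto dest: face_of_disjoint_interior face_of_imp_subset)
  have "open {x :: 'k ^ 'n. (\<Sum>i\<in>UNIV. norm (x $ i)) < 1}"
    by (intro open_Collect_less continuous_intros)
  then have "{x :: 'k ^ 'n. (\<Sum>i\<in>UNIV. norm (x $ i)) < 1} \<subseteq> interior cross_polytope"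
    by (intro interior_maximal) (auto simp: cross_polytope_eq)
  with disj have "\<not> (\<Sum>i\<in>UNIV. norm (x $ i)) < 1"
    using assms(2) by blast
  moreover have "(\<Sum>i\<in>UNIV. norm (x $ i)) \<le> 1"
    using sub assms(2) by (auto simp: cross_polytope_eq)
  ultimately show ?thesis by simp
qed

section \<open>The face of a nonzero vector\<close>

lemma inner_sgn_le: "inner (sgn u) x \<le> norm x" for u x :: "'a::real_inner"
  using norm_cauchy_schwarz[of "sgn u" x] by (cases "u = 0") (auto simp: norm_sgn)

text \<open>The equality case of Cauchy-Schwarz against a unit vector; for \<open>u = 0\<close> the
  assumption forces \<open>x = 0\<close>.\<close>

lemma inner_sgn_eq_norm_imp:
  fixes u x :: "'a::real_inner"
  assumes "inner (sgn u) x = norm x"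
  shows "x = norm x *\<^sub>R sgn u"
proof (cases "u = 0")
  case False
  then show ?thesis
    using assms norm_cauchy_schwarz_eq[of "sgn u" x] by (simp add: norm_sgn)
qed (use assms in auto)

lemma inner_norm_sgn: "inner x y = norm x * norm y * inner (sgn x) (sgn y)" for x y :: "'a::real_inner"
proof -
  have "inner x y = inner (norm x *\<^sub>R sgn x) (norm y *\<^sub>R sgn y)"
    by (simp only: norm_scaleR_sgn)
  then show ?thesis by simp
qed

text \<open>The functional is bounded by the norm sum, so 1 is the largest value it can take on the
  polytope. Since \<open>sgn 0 = 0\<close>, zero coordinates of \<open>v\<close> get coefficient 0,
  and \<open>v = 0\<close> yields the empty set, in agreement with \<open>sign_map\<close>.\<close>

definition phase_face ::
    "'k::{euclidean_space, real_normed_algebra_1} ^ 'n::finite \<Rightarrow> ('k ^ 'n) set" where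
  "phase_face v = cross_polytope \<inter> {x. inner (\<chi> i. sgn (v $ i)) x = 1}"

text \<open>The defects \<open>?d i\<close> are nonnegative, and their sum is at most
  \<open>1 - 1 = 0\<close>. So each vanishes and the equality case of Cauchy-Schwarz applies in
  every coordinate.\<close>

lemma phase_face_nth:
  assumes "x \<in> phase_face v"
  shows "x $ i = norm (x $ i) *\<^sub>R sgn (v $ i)"
proof (rule inner_sgn_eq_norm_imp)
  let ?d = "\<lambda>i. norm (x $ i) - inner (sgn (v $ i)) (x $ i)"
  have nn: "?d i \<ge> 0" for i
    by (simp add: inner_sgn_le)
  have "(\<Sum>i\<in>UNIV. ?d i) \<le> 0"
    using assms by (auto simp: phase_face_def cross_polytope_eq inner_vec_def sum_subtractf)
  then have "(\<Sum>i\<in>UNIV. ?d i) = 0"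
    by (rule antisym) (rule sum_nonneg, rule nn)
  then have "?d i = 0"
    using nn by (subst (asm) sum_nonneg_eq_0_iff) auto
  then show "inner (sgn (v $ i)) (x $ i) = norm (x $ i)" by simp
qed

lemma phase_face_cong:
  "(\<And>i. sgn (v $ i) = sgn (w $ i)) \<Longrightarrow> phase_face v = phase_face w"
  by (simp add: phase_face_def)

lemma l1_norm_pos:
  fixes v :: "'k::real_normed_vector ^ 'n::finite"
  assumes "v \<noteq> 0"
  shows "(\<Sum>i\<in>UNIV. norm (v $ i)) > 0"
proof -
  obtain i where "v $ i \<noteq> 0"
    using assms by (auto simp: vec_eq_iff)
  then show ?thesis
    by (intro sum_pos2[where i = i]) auto
qed

lemma inner_sgn_self: "inner (sgn u) u = norm u" for u :: "'a::real_inner"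
  by (cases "u = 0") (simp_all add: sgn_div_norm power2_norm_eq_inner[symmetric] power2_eq_square)

lemma normalized_mem_phase_face:
  assumes "v \<noteq> 0"
  shows "(1 / (\<Sum>i\<in>UNIV. norm (v $ i))) *\<^sub>R v \<in> phase_face v"
  using l1_norm_pos[OF assms]
  by (simp add: phase_face_def cross_polytope_eq inner_vec_def inner_sgn_self
      flip: sum_divide_distrib)

lemma phase_face_eq_iff:
  assumes "v \<noteq> 0" "w \<noteq> 0"
  shows "phase_face v = phase_face w \<longleftrightarrow> (\<forall>i. sgn (v $ i) = sgn (w $ i))"
proof
  \<comment> \<open>The normalized \<open>v\<close> lies in the face of \<open>w\<close>, whose
    points carry the phases of \<open>w\<close>. This compares phases only where \<open>v\<close> is
    nonzero; exchanging the two vectors covers the rest.\<close>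
  have half: "sgn (v $ i) = sgn (w $ i)"
    if "phase_face v = phase_face w" "v \<noteq> 0" "v $ i \<noteq> 0" for v w :: "'a ^ 'b" and i
  proof -
    define s where "s = 1 / (\<Sum>i\<in>UNIV. norm (v $ i))"
    have s: "s > 0" using l1_norm_pos[OF that(2)] by (simp add: s_def)
    have "s *\<^sub>R v \<in> phase_face w"
      using normalized_mem_phase_face[OF that(2)] that(1) by (simp add: s_def)
    from phase_face_nth[OF this, of i] s
    have "s *\<^sub>R v $ i = (s * norm (v $ i)) *\<^sub>R sgn (w $ i)" by simp
    then have "v $ i = norm (v $ i) *\<^sub>R sgn (w $ i)"
      using s unfolding scaleR_scaleR[symmetric] scaleR_cancel_left by blast
    then have "sgn (v $ i) = sgn (norm (v $ i) *\<^sub>R sgn (w $ i))" by (rule arg_cong)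
    also have "\<dots> = sgn (w $ i)" using that(3) by (simp add: sgn_scaleR sgn_sgn)
    finally show ?thesis .
  qed
  assume "phase_face v = phase_face w"
  then show "\<forall>i. sgn (v $ i) = sgn (w $ i)"
    using half[OF _ assms(1), of w] half[OF _ assms(2), of v] by (metis sgn_zero_iff)
qed (rule phase_face_cong, blast)

lemma phase_face_proper:
  assumes "v \<noteq> 0"
  shows "phase_face v \<in> proper_faces"
proof -
  have cvx: "convex cross_polytope" by (simp add: cross_polytope_def)
  have le: "inner (\<chi> i. sgn (v $ i)) x \<le> 1" if "x \<in> cross_polytope" for x
  proof -
    have "inner (\<chi> i. sgn (v $ i)) x \<le> (\<Sum>i\<in>UNIV. norm (x $ i))"
      by (simp add: inner_vec_def sum_mono inner_sgn_le)
    with that show ?thesis by (simp add: cross_polytope_eq)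
  qed
  have "phase_face v face_of cross_polytope"
    unfolding phase_face_def using cvx le by (rule face_of_Int_supporting_hyperplane_le)
  moreover have "closed (phase_face v)"
    unfolding phase_face_def cross_polytope_eq
    by (intro closed_Int closed_Collect_le closed_Collect_eq continuous_intros)
  moreover have "0 \<in> cross_polytope - phase_face v"
    by (simp add: phase_face_def zero_mem_cross_polytope)
  ultimately show ?thesis
    using normalized_mem_phase_face[OF assms] by (auto simp: proper_faces_def)
qed

text \<open>By convexity it suffices to prolong each segment from a point \<open>x\<close> of the
  face to \<open>z\<close> slightly beyond \<open>z\<close>. Coordinates vanishing at
  \<open>z\<close> vanish on the whole face; the others are positive multiples of the phases at
  \<open>z\<close> and stay nonnegative under a small prolongation.\<close>

lemma normalized_mem_rel_interior_phase_face:
  fixes v :: "'k::{euclidean_space, real_normed_algebra_1} ^ 'n::finite"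
  assumes "v \<noteq> 0"
  shows "(1 / (\<Sum>i\<in>UNIV. norm (v $ i))) *\<^sub>R v \<in> rel_interior (phase_face v)"
proof -
  define z where "z = (1 / (\<Sum>i\<in>UNIV. norm (v $ i))) *\<^sub>R v"
  have z: "z \<in> phase_face v"
    using normalized_mem_phase_face[OF assms] by (simp add: z_def)
  have z0: "sgn (v $ i) = 0" if "z $ i = 0" for i
    using that l1_norm_pos[OF assms] by (auto simp: z_def)
  have norm1: "(\<Sum>i\<in>UNIV. norm (x $ i)) = 1" if "x \<in> phase_face v" for x
    using proper_face_l1_norm[OF phase_face_proper[OF assms] that] .
  \<comment> \<open>The prolongation length is bounded by the smallest nonzero coordinate norm of
    \<open>z\<close>; the inserted 1 guarantees a nonempty set.\<close>
  define m where "m = Min (insert 1 ((\<lambda>i. norm (z $ i)) ` {i. z $ i \<noteq> 0}))"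
  have m0: "m > 0" by (simp add: m_def)
  have m: "m \<le> norm (z $ i)" if "z $ i \<noteq> 0" for i
    using that by (auto simp: m_def intro: Min_le)
  have ext: "(1 - (1 + m)) *\<^sub>R x + (1 + m) *\<^sub>R z \<in> phase_face v" if x: "x \<in> phase_face v" for x
  proof -
    let ?w = "(1 - (1 + m)) *\<^sub>R x + (1 + m) *\<^sub>R z"
    \<comment> \<open>The signed length of \<open>?w $ i\<close> along \<open>sgn (v $ i)\<close>.
      Once it is nonnegative it is the norm, so the norm sum of \<open>?w\<close> is affine in those
      of \<open>x\<close> and \<open>z\<close>, and equals 1.\<close>
    define c where "c i = - m * norm (x $ i) + (1 + m) * norm (z $ i)" for i
    have "norm (?w $ i) = c i" for i
    proof (cases "z $ i = 0")
      case True
      then have "x $ i = 0" using phase_face_nth[OF x, of i] z0 by simp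
      with True show ?thesis by (simp add: c_def)
    next
      case False
      have "norm (x $ i) \<le> 1"
        using norm1[OF x] member_le_sum[of i UNIV "\<lambda>i. norm (x $ i)"] by simp
      then have "m * norm (x $ i) \<le> m" using m0 by (simp add: mult_left_le)
      moreover have "0 \<le> m * norm (z $ i)" using m0 by simp
      ultimately have c0: "c i \<ge> 0"
        using m[OF False] by (simp add: c_def algebra_simps)
      have vi: "v $ i \<noteq> 0" using False by (auto simp: z_def)
      have "?w $ i = - m *\<^sub>R x $ i + (1 + m) *\<^sub>R z $ i" by simp
      also have "\<dots> = - m *\<^sub>R norm (x $ i) *\<^sub>R sgn (v $ i) + (1 + m) *\<^sub>R norm (z $ i) *\<^sub>R sgn (v $ i)"
        using phase_face_nth[OF x, of i] phase_face_nth[OF z, of i] by simp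
      also have "\<dots> = c i *\<^sub>R sgn (v $ i)"
        by (simp add: c_def algebra_simps)
      finally show ?thesis using c0 vi by (simp add: norm_sgn)
    qed
    then have "(\<Sum>i\<in>UNIV. norm (?w $ i)) = - m * (\<Sum>i\<in>UNIV. norm (x $ i)) + (1 + m) * (\<Sum>i\<in>UNIV. norm (z $ i))"
      by (simp only: c_def sum.distrib sum_distrib_left)
    also have "\<dots> = 1" by (simp add: norm1[OF x] norm1[OF z])
    finally have "?w \<in> cross_polytope" by (simp only: cross_polytope_eq mem_Collect_eq)
    moreover have "inner (\<chi> i. sgn (v $ i)) ?w = 1"
      using x z by (simp add: phase_face_def inner_add_right inner_diff_right)
    ultimately show ?thesis by (simp add: phase_face_def)
  qed
  have "convex (phase_face v)" "phase_face v \<noteq> {}"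
    using phase_face_proper[OF assms] by (auto simp: proper_faces_def face_of_imp_convex)
  moreover have "\<forall>x\<in>phase_face v. \<exists>e>1. (1 - e) *\<^sub>R x + e *\<^sub>R z \<in> phase_face v"
    by (intro ballI exI[of _ "1 + m"] conjI ext) (use m0 in simp)
  ultimately have "z \<in> rel_interior (phase_face v)"
    by (subst convex_rel_interior_iff)
  then show ?thesis by (simp add: z_def)
qed

text \<open>For uniqueness, a ray meets the unit sphere of the norm only once, so the ray parameter
  is the same for every candidate face; faces whose relative interiors share a point
  coincide.\<close>

lemma sign_map_nonzero:
  assumes "v \<noteq> 0"
  shows "sign_map v = phase_face v"
proof -
  let ?s = "\<Sum>i\<in>UNIV. norm (v $ i)"
  have "(THE F. F \<in> proper_faces \<and> (\<exists>t\<ge>0. t *\<^sub>R v \<in> rel_interior F)) = phase_face v"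
  proof (rule the_equality)
    show "phase_face v \<in> proper_faces \<and> (\<exists>t\<ge>0. t *\<^sub>R v \<in> rel_interior (phase_face v))"
      using phase_face_proper[OF assms] normalized_mem_rel_interior_phase_face[OF assms]
        l1_norm_pos[OF assms] by (auto intro!: exI[of _ "1 / ?s"])
  next
    fix F assume "F \<in> proper_faces \<and> (\<exists>t\<ge>0. t *\<^sub>R v \<in> rel_interior F)"
    then obtain t where F: "F \<in> proper_faces" and t: "t \<ge> 0" "t *\<^sub>R v \<in> rel_interior F"
      by blast
    have "(\<Sum>i\<in>UNIV. norm ((t *\<^sub>R v) $ i)) = 1"
      using proper_face_l1_norm[OF F] t(2) rel_interior_subset by blast
    then have "t * ?s = 1"
      using t(1) by (simp add: sum_distrib_left)
    then have "t = 1 / ?s"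
      using l1_norm_pos[OF assms] by (simp add: field_simps)
    then have "rel_interior F \<inter> rel_interior (phase_face v) \<noteq> {}"
      using t(2) normalized_mem_rel_interior_phase_face[OF assms] by auto
    then show "F = phase_face v"
      using F phase_face_proper[OF assms] by (intro face_of_eq) (auto simp: proper_faces_def)
  qed
  with assms show ?thesis by (simp add: sign_map_def)
qed

text \<open>This replaces faces by phases in the orthogonality argument; the zero vector fits in
  because only it has all phases 0.\<close>

lemma sign_map_eq_iff:
  fixes v w :: "'k::{euclidean_space, real_normed_algebra_1} ^ 'n::finite"
  shows "sign_map v = sign_map w \<longleftrightarrow> (\<forall>i. sgn (v $ i) = sgn (w $ i))"
proof -
  have ne: "sign_map u \<noteq> {}" if "u \<noteq> 0" for u :: "'k ^ 'n"
    using normalized_mem_phase_face[OF that] sign_map_nonzero[OF that] by auto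
  have 0: "sign_map (0 :: 'k ^ 'n) = {}" by (simp add: sign_map_def)
  show ?thesis
  proof (cases "v = 0 \<or> w = 0")
    case True
    have "(\<forall>i. sgn (v $ i) = sgn (w $ i)) \<longleftrightarrow> v = w"
      using True by (auto simp: vec_eq_iff sgn_zero_iff)
    with True show ?thesis using ne[of v] ne[of w] 0 by (metis)
  qed (simp add: sign_map_nonzero phase_face_eq_iff)
qed

lemma sign_map_mem_sign_vectors:
  fixes v :: "'k::{euclidean_space, real_normed_algebra_1} ^ 'n::finite"
  shows "sign_map v \<in> sign_vectors"
  by (cases "v = 0") (simp_all add: sign_vectors_def sign_map_nonzero phase_face_proper, simp add: sign_map_def)

section \<open>Orthogonality\<close>

text \<open>Separating 0 from the convex set \<open>S = C + W\<close> gives only a weak inequality.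
  Choosing the normal \<open>a\<close> in \<open>span S\<close> prevents it from vanishing on all of
  \<open>S\<close>, which yields the strict inequality at some \<open>j\<close>.\<close>

lemma phase_separation:
  fixes W :: "('k::euclidean_space ^ 'n::finite) set"
  assumes W: "subspace W" and no: "\<And>w. w \<in> W \<Longrightarrow> \<exists>i. sgn (w $ i) \<noteq> sgn (y $ i)"
  obtains a j where "a \<in> orthogonal_comp W" "\<And>i. 0 \<le> inner (a $ i) (y $ i)"
    "0 < inner (a $ j) (y $ j)"
proof -
  define C where "C = {c. \<exists>t. (\<forall>i. 0 < t i) \<and> c = (\<chi> i. t i *\<^sub>R y $ i)}"
  define S where "S = (\<Union>c\<in>C. \<Union>w\<in>W. {c + w})"
  have C_sgn: "sgn (c $ i) = sgn (y $ i)" if "c \<in> C" for c i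
    using that by (auto simp: C_def sgn_scaleR)
  have yC: "y \<in> C"
    unfolding C_def by (auto intro!: exI[of _ "\<lambda>_. 1"] simp: vec_eq_iff)
  have "convex C"
  proof (rule convexI)
    fix c d and p q :: real
    assume "c \<in> C" "d \<in> C" and pq: "0 \<le> p" "0 \<le> q" "p + q = 1"
    then obtain t u where t: "\<And>i. 0 < t i" "c = (\<chi> i. t i *\<^sub>R y $ i)"
      and u: "\<And>i. 0 < u i" "d = (\<chi> i. u i *\<^sub>R y $ i)"
      by (auto simp: C_def)
    have "p * t i + q * u i > 0" for i
    proof (cases "p = 0")
      case False
      then have "0 < p * t i" "0 \<le> q * u i" using pq t(1)[of i] u(1)[of i] by simp_all
      then show ?thesis by linarith
    qed (use pq u in auto)
    then show "p *\<^sub>R c + q *\<^sub>R d \<in> C"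
      by (auto simp: C_def t(2) u(2) vec_eq_iff scaleR_add_left
          intro!: exI[of _ "\<lambda>i. p * t i + q * u i"])
  qed
  then have "convex S"
    unfolding S_def by (intro convex_sums subspace_imp_convex[OF W])
  moreover have "S \<noteq> {}"
    using yC subspace_0[OF W] by (auto simp: S_def)
  moreover have "0 \<notin> S"
  proof
    assume "0 \<in> S"
    then obtain c w where "c \<in> C" "w \<in> W" "c = - w"
      unfolding S_def by (smt (verit) UN_E eq_neg_iff_add_eq_0 singletonD)
    then have "c \<in> C" "c \<in> W" using W by (auto simp: subspace_neg)
    then show False using no C_sgn by blast
  qed
  ultimately obtain a where a: "a \<in> span S" "a \<noteq> 0" "\<And>x. x \<in> S \<Longrightarrow> 0 \<le> inner a x"
    by (rule separating_hyperplane_set_0_inspan) blast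
  have aCW: "0 \<le> inner a c + r * inner a w" if "c \<in> C" "w \<in> W" for c w r
  proof -
    have "c + r *\<^sub>R w \<in> S" using that subspace_scale[OF W] unfolding S_def by blast
    from a(3)[OF this] show ?thesis by (simp add: inner_add_right)
  qed
  have aW: "inner a w = 0" if "w \<in> W" for w
  proof (rule ccontr)
    assume "inner a w \<noteq> 0"
    \<comment> \<open>The multiple of \<open>w\<close> is chosen so that the bound reads
      \<open>0 \<le> -1\<close>.\<close>
    with aCW[OF yC that, of "- (inner a y + 1) / inner a w"] show False by simp
  qed
  then have orth: "a \<in> orthogonal_comp W"
    by (auto simp: orthogonal_comp_def orthogonal_def inner_commute)
  have nn: "0 \<le> inner (a $ i) (y $ i)" for i
  proof (rule ccontr)
    define b where "b = inner (a $ i) (y $ i)"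
    assume "\<not> 0 \<le> inner (a $ i) (y $ i)"
    then have b: "b < 0" by (simp add: b_def)
    \<comment> \<open>Stretching coordinate \<open>i\<close> of \<open>y\<close> by the factor
      \<open>1 + r\<close> stays in \<open>C\<close> and changes the inner product with
      \<open>a\<close> by \<open>r * b\<close>; this \<open>r\<close> makes the result at most
      -1.\<close>
    define r where "r = (\<bar>inner a y\<bar> + 1) / (- b)"
    have r: "r > 0" using b unfolding r_def by (intro divide_pos_pos) auto
    have "y + r *\<^sub>R axis i (y $ i) \<in> C"
      unfolding C_def using r
      by (auto intro!: exI[of _ "\<lambda>j. if j = i then 1 + r else 1"]
          simp: vec_eq_iff axis_def scaleR_add_left)
    from aCW[OF this subspace_0[OF W], of 0]
    have "0 \<le> inner a y + r * b" by (simp add: inner_add_right inner_axis b_def)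
    moreover have "r * b = - (\<bar>inner a y\<bar> + 1)" using b by (simp add: r_def)
    ultimately show False by linarith
  qed
  obtain j where "0 < inner (a $ j) (y $ j)"
  proof (rule ccontr)
    assume "\<not> thesis"
    then have z: "inner (a $ j) (y $ j) = 0" for j
      using nn[of j] that by (metis order_le_less)
    \<comment> \<open>If no \<open>j\<close> works, \<open>a\<close> is orthogonal to
      \<open>S\<close>, hence to its span and so to itself.\<close>
    have "inner a x = 0" if "x \<in> S" for x
    proof -
      obtain t w where "x = (\<chi> i. t i *\<^sub>R y $ i) + w" "w \<in> W"
        using \<open>x \<in> S\<close> by (auto simp: S_def C_def)
      then show ?thesis
        using aW z by (simp add: inner_add_right inner_vec_def[of a "vec_lambda _"])
    qed
    then have "orthogonal a a"
      by (intro orthogonal_to_span[OF a(1)]) (simp add: orthogonal_def)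
    with a(2) show False by (simp add: orthogonal_self)
  qed
  with orth nn that show thesis by blast
qed

text \<open>The function \<open>re\<close> stands for the real part, so that one argument serves all
  three scalar rings. Commutativity is avoided: scalars are only pulled out of the first argument of
  the form, on the left.\<close>

lemma matroid_of_orth_complement:
  fixes re :: "'k::{euclidean_space, real_normed_div_algebra, conjugation} \<Rightarrow> real"
    and V :: "('k ^ 'n::finite) set"
  assumes lin: "linear re" and re1: "re 1 \<noteq> 0"
    and inner_re: "\<And>x y :: 'k. inner x y = re (x * conjug y)"
    and V: "left_subspace V"
  shows "matroid_of (orth_complement V) = matroid_perp (matroid_of V)"
proof -
  have inner_hform: "inner x y = re (hform x y)" for x y :: "'k ^ 'n"
    by (simp add: inner_vec_def hform_def inner_re linear_sum[OF lin])
  have hform_scale: "hform (c *s x) y = c * hform x y" for c and x y :: "'k ^ 'n"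
    by (simp add: hform_def sum_distrib_left mult.assoc)
  have "subspace V"
  proof -
    have "r *\<^sub>R x = (r *\<^sub>R 1) *s x" for r and x :: "'k ^ 'n"
      by (simp add: vec_eq_iff)
    then show ?thesis using V by (auto simp: left_subspace_def subspace_def)
  qed
  have comp: "orth_complement V = orthogonal_comp V"
  proof (intro subset_antisym subsetI)
    fix y assume "y \<in> orth_complement V"
    then show "y \<in> orthogonal_comp V"
      by (auto simp: orth_complement_def orthogonal_comp_def orthogonal_def inner_hform
          linear_0[OF lin])
  next
    fix y assume y: "y \<in> orthogonal_comp V"
    have "hform x y = 0" if "x \<in> V" for x
    proof (rule ccontr)
      assume nz: "hform x y \<noteq> 0"
      \<comment> \<open>Left scaling inside \<open>V\<close> turns the value of the form into 1,
        whose image under \<open>re\<close> is nonzero, contradicting real orthogonality.\<close>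
      have "inverse (hform x y) *s x \<in> V" using V that by (simp add: left_subspace_def)
      then have "inner (inverse (hform x y) *s x) y = 0"
        using y by (auto simp: orthogonal_comp_def orthogonal_def)
      with nz re1 show False by (simp add: inner_hform hform_scale)
    qed
    then show "y \<in> orth_complement V" by (simp add: orth_complement_def)
  qed
  show ?thesis
  proof (intro subset_antisym subsetI)
    fix b assume "b \<in> matroid_of (orth_complement V)"
    then show "b \<in> matroid_perp (matroid_of V)"
      by (force simp: matroid_of_def matroid_perp_def sign_orthogonal_def orth_complement_def
          sign_map_mem_sign_vectors)
  next
    fix b assume b: "b \<in> matroid_perp (matroid_of V)"
    have orth: "\<exists>x y. sign_map v = sign_map x \<and> b = sign_map y \<and> hform x y = 0" if "v \<in> V" for v
      using b that by (auto simp: matroid_perp_def matroid_of_def sign_orthogonal_def)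
    \<comment> \<open>Orthogonality to the sign vector of 0 supplies a vector \<open>y\<close>
      representing \<open>b\<close>.\<close>
    have "0 \<in> V" using V by (simp add: left_subspace_def)
    from orth[OF this] obtain y where y: "b = sign_map y" by blast
    have "\<exists>w\<in>orthogonal_comp V. \<forall>i. sgn (w $ i) = sgn (y $ i)"
    proof (rule ccontr)
      assume "\<not> ?thesis"
      then obtain a j where a: "a \<in> orthogonal_comp (orthogonal_comp V)"
          "\<And>i. 0 \<le> inner (a $ i) (y $ i)" "0 < inner (a $ j) (y $ j)"
        by (auto intro: phase_separation[of "orthogonal_comp V" y, OF subspace_orthogonal_comp])
      \<comment> \<open>In finite dimension the double real orthogonal complement of a subspace is
        the subspace itself.\<close>
      then have "a \<in> V" using \<open>subspace V\<close> by (simp add: orthogonal_comp_self)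
      from orth[OF this] obtain x' y' where eq: "sign_map a = sign_map x'" "sign_map y = sign_map y'"
        and h: "hform x' y' = 0"
        using y by auto
      \<comment> \<open>Coordinatewise, the sign of the real inner product depends only on the
        phases, so the inequalities for \<open>a\<close> and \<open>y\<close> carry over to
        \<open>x'\<close> and \<open>y'\<close>.\<close>
      have inner_eq: "inner (x' $ i) (y' $ i)
          = (norm (x' $ i) * norm (y' $ i)) * inner (sgn (a $ i)) (sgn (y $ i))" for i
      proof -
        have "sgn (a $ i) = sgn (x' $ i)" "sgn (y $ i) = sgn (y' $ i)"
          using eq by (simp_all add: sign_map_eq_iff)
        then show ?thesis
          using inner_norm_sgn[of "x' $ i" "y' $ i"] by simp
      qed
      have "0 \<le> inner (x' $ i) (y' $ i)" for i
        unfolding inner_eq using a(2)[of i] by (simp add: sgn_div_norm)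
      moreover have "0 < inner (x' $ j) (y' $ j)"
      proof -
        have nz: "a $ j \<noteq> 0" "y $ j \<noteq> 0" using a(3) by auto
        then have "x' $ j \<noteq> 0" "y' $ j \<noteq> 0"
          using eq by (auto simp: sign_map_eq_iff) (metis sgn_zero_iff)+
        with nz a(3) show ?thesis unfolding inner_eq by (simp add: sgn_div_norm)
      qed
      ultimately have "0 < inner x' y'"
        unfolding inner_vec_def by (intro sum_pos2[where i = j]) auto
      then show False by (simp add: inner_hform h linear_0[OF lin])
    qed
    then show "b \<in> matroid_of (orth_complement V)"
      unfolding comp matroid_of_def y using sign_map_eq_iff by (metis image_eqI)
  qed
qed

theorem proposition3p5:
  shows "(\<forall>V :: (real ^ 'n::finite) set. left_subspace V \<longrightarrow>
            matroid_of (orth_complement V) = matroid_perp (matroid_of V)) \<and>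
         (\<forall>V :: (complex ^ 'n) set. left_subspace V \<longrightarrow>
            matroid_of (orth_complement V) = matroid_perp (matroid_of V)) \<and>
         (\<forall>V :: (quat ^ 'n) set. left_subspace V \<longrightarrow>
            matroid_of (orth_complement V) = matroid_perp (matroid_of V))"
proof (intro conjI allI impI)
  fix V :: "(real ^ 'n) set"
  assume "left_subspace V"
  then show "matroid_of (orth_complement V) = matroid_perp (matroid_of V)"
    by (intro matroid_of_orth_complement[where re = "\<lambda>x. x"])
      (simp_all add: linear_iff conjug_real_def)
next
  fix V :: "(complex ^ 'n) set"
  assume "left_subspace V"
  then show "matroid_of (orth_complement V) = matroid_perp (matroid_of V)"
    by (intro matroid_of_orth_complement[where re = Re])
      (simp_all add: linear_iff conjug_complex_def inner_complex_def)
next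
  fix V :: "(quat ^ 'n) set"
  assume "left_subspace V"
  then show "matroid_of (orth_complement V) = matroid_perp (matroid_of V)"
    by (intro matroid_of_orth_complement[where re = qRe])
      (simp_all add: linear_iff conjug_quat_def inner_quat_def)
qed

end
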